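(* Let $n,k$ be natural numbers with $1\le k\le n$, and let $\mathcal{MD}_{n,k}$ be the set of all $(n+1)\times(n+1)$ complex matrices $A=(a_{ij})_{i,j=0}^n$ such that $a_{ij}=0$ whenever $|i-j|\notin\{0,k,2k,\dots,sk\}$, where $s=\lfloor n/k\rfloor$. Then: (i) The set $\mathcal{MD}_{n,k}$ is closed under matrix multiplication and under taking powers with positive integer exponents. (ii) The subset of $\mathcal{MD}_{n,k}$ consisting of all nonsingular matrices is closed under taking inverses and under taking powers with negative (and also nonnegative) integer exponents.
   Context: Rows and columns of matrices are indexed by $0,1,\dots,n$. The elements of $\mathcal{MD}_{n,k}$ are the multidiagonal matrices whose nonzero entries lie only on the main diagonal and on the sub- and superdiagonals at distances $k,2k,\dots,sk$ from it, with $s=\lfloor n/k\rfloor$ the maximal possible number; entries on these diagonals are arbitrary complex numbers and may be zero. *)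

theory Defs
  imports Complex_Main "Jordan_Normal_Form.Gauss_Jordan_Elimination"
begin

(* carrier_mat (n + 1) (n + 1) has row and column indices 0, ..., n *)
definition MD :: "nat \<Rightarrow> nat \<Rightarrow> complex mat set" where
  "MD n k = {A \<in> carrier_mat (n + 1) (n + 1).
     \<forall>i \<le> n. \<forall>j \<le> n. \<bar>int i - int j\<bar> \<notin> {int (m * k) |m. m \<le> n div k} \<longrightarrow> A $$ (i, j) = 0}"

definition MD_nonsing :: "nat \<Rightarrow> nat \<Rightarrow> complex mat set" where
  "MD_nonsing n k = {A \<in> MD n k. invertible_mat A}"

(* Only meaningful for z < 0 when A is invertible: otherwise mat_inverse A = None. *)
definition mat_int_pow :: "'a :: field mat \<Rightarrow> int \<Rightarrow> 'a mat" where
  "mat_int_pow A z =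
     (if z < 0 then the (mat_inverse A) ^\<^sub>m nat (- z) else A ^\<^sub>m nat z)"

end

theory Submission
  imports Defs "Jordan_Normal_Form.Determinant"
begin

text \<open>Membership in \<^term>\<open>MD n k\<close> says that entries vanish unless the two indices are congruent
  modulo \<open>k\<close>. For a nonsingular such \<open>A\<close> with inverse \<open>B\<close>, replace by zero all entries of \<open>B\<close>
  at incongruent positions; the result \<open>B'\<close> still satisfies \<open>A B' = 1\<close>, so \<open>B' = B\<close>.\<close>

text \<open>Since \<open>i\<close> and \<open>j\<close> lie between \<open>0\<close> and
  \<open>n\<close>, a difference \<open>m * k\<close> of two indices satisfies
  \<open>m * k \<le> n\<close>, so the bound \<open>m \<le> n div k\<close> holds automatically.
  What remains is divisibility of \<open>i - j\<close> by \<open>k\<close>, an equivalence relation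
  on indices; the later arguments use only this form.\<close>

lemma MD_iff:
  assumes "1 \<le> k"
  shows "A \<in> MD n k \<longleftrightarrow> A \<in> carrier_mat (n + 1) (n + 1) \<and>
    (\<forall>i \<le> n. \<forall>j \<le> n. i mod k \<noteq> j mod k \<longrightarrow> A $$ (i, j) = 0)"
proof -
  have "\<bar>int i - int j\<bar> \<in> {int (m * k) |m. m \<le> n div k} \<longleftrightarrow> i mod k = j mod k"
    if ij: "i \<le> n" "j \<le> n" for i j
  proof -
    have *: "\<bar>int i - int j\<bar> \<in> {int (m * k) |m. m \<le> n div k} \<longleftrightarrow> int k dvd int i - int j"
    proof
      assume "int k dvd int i - int j"
      then have "k dvd nat \<bar>int i - int j\<bar>"
        by (simp add: nat_dvd_iff nat_abs_dvd_iff)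
      then obtain m where m: "nat \<bar>int i - int j\<bar> = m * k"
        by (auto simp: dvd_def mult.commute)
      have "m * k \<le> n" using m ij by linarith
      then have "m \<le> n div k"
        using assms by (simp add: less_eq_div_iff_mult_less_eq)
      moreover have "\<bar>int i - int j\<bar> = int (m * k)" using m by linarith
      ultimately show "\<bar>int i - int j\<bar> \<in> {int (m * k) |m. m \<le> n div k}" by blast
    next
      assume "\<bar>int i - int j\<bar> \<in> {int (m * k) |m. m \<le> n div k}"
      then obtain m where "\<bar>int i - int j\<bar> = int m * int k" by auto
      then show "int k dvd int i - int j"
        by (metis dvd_abs_iff dvd_triv_right)
    qed
    also have "\<dots> \<longleftrightarrow> int i mod int k = int j mod int k"
      by (simp add: mod_eq_dvd_iff)
    also have "\<dots> \<longleftrightarrow> i mod k = j mod k"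
      by (metis of_nat_eq_iff zmod_int)
    finally show ?thesis .
  qed
  then show ?thesis unfolding MD_def by blast
qed

lemma MD_carrier: "A \<in> MD n k \<Longrightarrow> A \<in> carrier_mat (n + 1) (n + 1)"
  by (simp add: MD_def)

lemma one_mat_MD:
  assumes "1 \<le> k"
  shows "1\<^sub>m (n + 1) \<in> MD n k"
  using assms by (auto simp: MD_iff)

lemma mult_MD:
  assumes k: "1 \<le> k" and A: "A \<in> MD n k" and B: "B \<in> MD n k"
  shows "A * B \<in> MD n k"
proof -
  have "(A * B) $$ (i, j) = 0" if "i \<le> n" "j \<le> n" "i mod k \<noteq> j mod k" for i j
  proof -
    have "(A * B) $$ (i, j) = (\<Sum>l<n + 1. A $$ (i, l) * B $$ (l, j))"
      using that MD_carrier[OF A] MD_carrier[OF B]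
      by (simp add: scalar_prod_def atLeast0LessThan)
    also have "\<dots> = 0"
    \<comment> \<open>As \<open>i\<close> and \<open>j\<close> are incongruent, \<open>l\<close>
      cannot be congruent to both, so one of the two factors is zero.\<close>
    proof (rule sum.neutral, rule ballI)
      fix l assume "l \<in> {..<n + 1}"
      then show "A $$ (i, l) * B $$ (l, j) = 0"
        using A B that by (cases "i mod k = l mod k") (auto simp: MD_iff[OF k])
    qed
    finally show ?thesis .
  qed
  then show ?thesis
    using MD_carrier[OF A] MD_carrier[OF B] by (simp add: MD_iff[OF k])
qed

lemma pow_MD:
  assumes k: "1 \<le> k" and A: "A \<in> MD n k"
  shows "A ^\<^sub>m p \<in> MD n k"
proof (induction p)
  case 0
  then show ?case using one_mat_MD[OF k] MD_carrier[OF A] by simp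
next
  case (Suc p)
  then show ?case using mult_MD[OF k _ A] by simp
qed

lemma right_inverse_MD:
  assumes k: "1 \<le> k" and A: "A \<in> MD n k" and B: "B \<in> carrier_mat (n + 1) (n + 1)"
    and AB: "A * B = 1\<^sub>m (n + 1)"
  shows "B \<in> MD n k"
proof -
  note A' = MD_carrier[OF A]
  define C where "C = mat (n + 1) (n + 1) (\<lambda>(i, j). if i mod k = j mod k then B $$ (i, j) else 0)"
  have C: "C \<in> MD n k" by (simp add: MD_iff[OF k] C_def)
  note C' = MD_carrier[OF C]
  have AC: "A * C = 1\<^sub>m (n + 1)"
  proof (rule eq_matI)
    fix i j assume "i < dim_row (1\<^sub>m (n + 1) :: complex mat)" "j < dim_col (1\<^sub>m (n + 1) :: complex mat)"
    then have ij: "i \<le> n" "j \<le> n" by auto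
    show "(A * C) $$ (i, j) = 1\<^sub>m (n + 1) $$ (i, j)"
    proof (cases "i mod k = j mod k")
      case True
      have "(A * C) $$ (i, j) = (\<Sum>l<n + 1. A $$ (i, l) * C $$ (l, j))"
        using ij A' C' by (simp add: scalar_prod_def atLeast0LessThan)
      \<comment> \<open>\<open>C\<close> and \<open>B\<close> can differ at \<open>(l, j)\<close>
        only if \<open>l\<close> is incongruent to \<open>j\<close>, hence to \<open>i\<close>;
        there \<open>A $$ (i, l)\<close> is zero.\<close>
      also have "\<dots> = (\<Sum>l<n + 1. A $$ (i, l) * B $$ (l, j))"
      proof (rule sum.cong[OF refl])
        fix l assume "l \<in> {..<n + 1}"
        then show "A $$ (i, l) * C $$ (l, j) = A $$ (i, l) * B $$ (l, j)"
          using A ij True by (cases "i mod k = l mod k") (auto simp: MD_iff[OF k] C_def)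
      qed
      also have "\<dots> = (A * B) $$ (i, j)"
        using ij A' B by (simp add: scalar_prod_def atLeast0LessThan)
      finally show ?thesis using AB by simp
    next
      case False
      \<comment> \<open>Both sides vanish: the left because \<open>A * C\<close> is in
        \<open>MD n k\<close>, the right because incongruent indices are distinct.\<close>
      then show ?thesis using mult_MD[OF k A C] ij by (auto simp: MD_iff[OF k])
    qed
  qed (use A' C' in auto)
  have BA: "B * A = 1\<^sub>m (n + 1)" by (rule mat_mult_left_right_inverse[OF A' B AB])
  have "B = B * (A * C)" using AC B by simp
  also have "\<dots> = (B * A) * C" using B A' C' by (simp add: assoc_mult_mat)
  also have "\<dots> = C" using BA C' by simp
  finally show ?thesis using C by simp
qed

lemma invertible_mat_iff_right_inverse:
  fixes A :: "'a :: field mat"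
  assumes A: "A \<in> carrier_mat m m"
  shows "invertible_mat A \<longleftrightarrow> (\<exists>B \<in> carrier_mat m m. A * B = 1\<^sub>m m)"
proof
  assume "invertible_mat A"
  then obtain B where B: "A * B = 1\<^sub>m (dim_row A)" "B * A = 1\<^sub>m (dim_row B)"
    by (auto simp: invertible_mat_def inverts_mat_def)
  \<comment> \<open>\<open>invertible_mat\<close> does not fix the size of the inverse; it is
    recovered by comparing column counts in the two equations.\<close>
  have "dim_col B = m" "dim_row B = m"
    using arg_cong[OF B(1), of dim_col] arg_cong[OF B(2), of dim_col] A by simp_all
  then have "B \<in> carrier_mat m m" by auto
  then show "\<exists>B \<in> carrier_mat m m. A * B = 1\<^sub>m m" using A B by auto
next
  assume "\<exists>B \<in> carrier_mat m m. A * B = 1\<^sub>m m"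
  then obtain B where B: "B \<in> carrier_mat m m" "A * B = 1\<^sub>m m" by blast
  moreover have "B * A = 1\<^sub>m m" using mat_mult_left_right_inverse[OF A B] .
  ultimately show "invertible_mat A"
    using A by (auto simp: invertible_mat_def inverts_mat_def)
qed

lemma invertible_mat_mult:
  fixes A B :: "'a :: field mat"
  assumes A: "A \<in> carrier_mat m m" "invertible_mat A" and B: "B \<in> carrier_mat m m" "invertible_mat B"
  shows "invertible_mat (A * B)"
proof -
  obtain A' B' where A': "A' \<in> carrier_mat m m" "A * A' = 1\<^sub>m m"
    and B': "B' \<in> carrier_mat m m" "B * B' = 1\<^sub>m m"
    using A B by (auto simp: invertible_mat_iff_right_inverse)
  have "(A * B) * (B' * A') = A * ((B * B') * A')"
    using A(1) B(1) A'(1) B'(1) by (simp add: assoc_mult_mat[where ?n\<^sub>1 = m and ?n\<^sub>2 = m and ?n\<^sub>3 = m and ?n\<^sub>4 = m])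
  also have "\<dots> = 1\<^sub>m m" using A' B' by simp
  finally show ?thesis
    using A(1) B(1) A'(1) B'(1) invertible_mat_iff_right_inverse[of "A * B" m]
    by (metis mult_carrier_mat)
qed

text \<open>The form \<open>Some B\<close> guarantees that \<open>the (mat_inverse A)\<close> in
  \<open>mat_int_pow\<close> denotes the actual inverse.\<close>

lemma MD_nonsing_inverse:
  assumes k: "1 \<le> k" and A: "A \<in> MD_nonsing n k"
  shows "\<exists>B. mat_inverse A = Some B \<and> B \<in> MD_nonsing n k"
proof -
  have AM: "A \<in> MD n k" and inv: "invertible_mat A" using A by (auto simp: MD_nonsing_def)
  note A' = MD_carrier[OF AM]
  obtain C where C: "C \<in> carrier_mat (n + 1) (n + 1)" "A * C = 1\<^sub>m (n + 1)"
    using inv A' by (auto simp: invertible_mat_iff_right_inverse)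
  have "C * A = 1\<^sub>m (n + 1)" using mat_mult_left_right_inverse[OF A' C] .
  \<comment> \<open>The specification of \<open>mat_inverse\<close> is phrased with the units of the
    matrix ring: the result \<open>None\<close> would mean that \<open>A\<close> is not a
    unit.\<close>
  then have "A \<in> Units (ring_mat TYPE(complex) (n + 1) ())"
    using A' C by (auto simp: Units_def ring_mat_def)
  then obtain B where B: "mat_inverse A = Some B"
    using mat_inverse(1)[OF A', where b = "()"] by (cases "mat_inverse A") auto
  have AB: "A * B = 1\<^sub>m (n + 1)" "B * A = 1\<^sub>m (n + 1)" "B \<in> carrier_mat (n + 1) (n + 1)"
    using mat_inverse(2)[OF A' B] by auto
  then have "B \<in> MD n k" using right_inverse_MD[OF k AM] by blast
  moreover have "invertible_mat B"
    using AB A' by (auto simp: invertible_mat_iff_right_inverse[where m = "n + 1"])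
  ultimately show ?thesis using B by (simp add: MD_nonsing_def)
qed

lemma pow_MD_nonsing:
  assumes k: "1 \<le> k" and A: "A \<in> MD_nonsing n k"
  shows "A ^\<^sub>m p \<in> MD_nonsing n k"
proof -
  have AM: "A \<in> MD n k" and inv: "invertible_mat A" using A by (auto simp: MD_nonsing_def)
  note A' = MD_carrier[OF AM]
  have "invertible_mat (A ^\<^sub>m p)"
  proof (induction p)
    case 0
    have "invertible_mat (1\<^sub>m (n + 1) :: complex mat)"
      by (auto simp: invertible_mat_iff_right_inverse[where m = "n + 1"] intro!: bexI[of _ "1\<^sub>m (n + 1)"])
    then show ?case using A' by simp
  next
    case (Suc p)
    then show ?case using invertible_mat_mult[OF _ _ A' inv] pow_carrier_mat[OF A'] by simp
  qed
  then show ?thesis using pow_MD[OF k AM] by (simp add: MD_nonsing_def)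
qed

theorem theorem1:
  fixes n k :: nat
  assumes "1 \<le> k" and "k \<le> n"
  shows "(\<forall>A \<in> MD n k. \<forall>B \<in> MD n k. A * B \<in> MD n k) \<and>
    (\<forall>A \<in> MD n k. \<forall>p :: nat. p > 0 \<longrightarrow> A ^\<^sub>m p \<in> MD n k) \<and>
    (\<forall>A \<in> MD_nonsing n k. \<exists>B. mat_inverse A = Some B \<and> B \<in> MD_nonsing n k) \<and>
    (\<forall>A \<in> MD_nonsing n k. \<forall>z :: int. mat_int_pow A z \<in> MD_nonsing n k)"
proof (intro conjI ballI allI impI)
  fix A and z :: int assume A: "A \<in> MD_nonsing n k"
  \<comment> \<open>For \<open>z < 0\<close> this is a natural power of the inverse, otherwise one
    of \<open>A\<close> itself; both bases are in \<open>MD_nonsing n k\<close>, so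
    \<open>pow_MD_nonsing\<close> covers both cases, including the exponent
    \<open>0\<close>.\<close>
  show "mat_int_pow A z \<in> MD_nonsing n k"
    using MD_nonsing_inverse[OF assms(1) A] A pow_MD_nonsing[OF assms(1)]
    by (auto simp: mat_int_pow_def)
qed (use assms(1) in \<open>simp_all add: mult_MD pow_MD MD_nonsing_inverse\<close>)

end
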